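(* Consider the source model in which all source symbols have the same length $L$, in the asymptotic regime described in the context. For modified fixed-length deduplication (mFLD) with first-stage parsing length $D=L$ and chunk length $\ell=\ell(B)$, if $\ell2^\ell=O(AL)$ or $\ell\le\frac{\log(B/A)-2}{H(\frac12,\delta)}$, then $$\mathbb{E}[\mathcal{L}_{mF}(\boldsymbol{s})]\ge\frac1{12}BL(1+o(1)),\qquad\text{as }B\to\infty,$$ where the $o(1)$ term is independent of $\delta$.
   Context: All logarithms are base 2. $H(p,q)=p\log\frac1q+(1-p)\log\frac1{1-q}$ is the binary cross entropy. Source model (equal symbol lengths). Parameters: positive integers $A,B,L$ and an edit probability $\delta$. Source symbols $X_1,\dots,X_A$ are drawn independently and uniformly from $\{0,1\}^L$ (with replacement). Then, independently for $b=1,\dots,B$, an index $J_b$ is drawn uniformly from $\{1,\dots,A\}$ and the source block $Y_b$ is obtained from $X_{J_b}$ by a $\delta$-edit, i.e. by flipping each bit independently with probability $\delta$. The data stream is $\boldsymbol{s}=Y_1Y_2\cdots Y_B$. Asymptotic regime. $B\to\infty$; $A$ and $L$ are functions of $B$ tending to infinity with $A\le B^{1-k_2}$ for a fixed $0<k_2<1$ and $L=\Theta(B^{k_1})$ for a fixed $k_1>0$; $\delta\in(0,\frac12)$ is constant. Dictionary encoding of a parsed string. Given a parsing of $\boldsymbol{s}$ into consecutive chunks, the encoding starts with a prefix-free (Elias gamma) encoding of $|\boldsymbol{s}|$. Chunks are then processed in order, starting with an empty dictionary. A chunk different from all previous chunks is encoded as the bit 1 followed by the chunk itself, and is entered into the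 dictionary. A chunk equal to an earlier one is encoded as the bit 0 followed by a pointer (index) to its dictionary entry; if the current dictionary has size $t$, the pointer takes $\lceil\log t\rceil$ bits. Modified fixed-length deduplication (mFLD) with first-stage parsing length $D$ and chunk length $\ell\le D$: $\boldsymbol{s}$ is parsed into consecutive segments of length $D$ (the last one possibly shorter), and each segment is parsed into consecutive chunks of length $\ell$ (the last chunk of a segment possibly shorter). The dictionary encoding is applied to the resulting chunks. $\mathcal{L}_{mF}(\boldsymbol{s})$ is the number of bits used to encode $\boldsymbol{s}$. *)

theory Defs
  imports
    "HOL-Probability.Probability"
    "HOL-Library.Landau_Symbols"
    "HOL-Library.Monad_Syntax"
begin

definition cross_entropy :: "real \<Rightarrow> real \<Rightarrow> real" where
  "cross_entropy p q = p * log 2 (1 / q) + (1 - p) * log 2 (1 / (1 - q))"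

primrec edit_pmf :: "real \<Rightarrow> bool list \<Rightarrow> bool list pmf" where
  "edit_pmf \<delta> [] = return_pmf []"
| "edit_pmf \<delta> (x # xs) = do {
     flip \<leftarrow> bernoulli_pmf \<delta>;
     ys \<leftarrow> edit_pmf \<delta> xs;
     return_pmf ((x \<noteq> flip) # ys)
   }"

definition source_symbols_pmf :: "nat \<Rightarrow> nat \<Rightarrow> bool list list pmf" where
  "source_symbols_pmf A L = replicate_pmf A (pmf_of_set {xs :: bool list. length xs = L})"

definition source_block_pmf :: "real \<Rightarrow> bool list list \<Rightarrow> bool list pmf" where
  "source_block_pmf \<delta> Xs = do {
     j \<leftarrow> pmf_of_set {..<length Xs};
     edit_pmf \<delta> (Xs ! j)
   }"

definition source_pmf :: "nat \<Rightarrow> nat \<Rightarrow> nat \<Rightarrow> real \<Rightarrow> bool list pmf" where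
  "source_pmf A B L \<delta> = do {
     Xs \<leftarrow> source_symbols_pmf A L;
     Ys \<leftarrow> replicate_pmf B (source_block_pmf \<delta> Xs);
     return_pmf (concat Ys)
   }"

text \<open>The \<open>w\<close> least significant bits of \<open>n\<close>, most significant bit first.\<close>

definition to_bits :: "nat \<Rightarrow> nat \<Rightarrow> bool list" where
  "to_bits w n = map (\<lambda>i. odd (n div 2 ^ i)) (rev [0..<w])"

text \<open>Elias gamma code of a positive integer.\<close>

definition elias_gamma :: "nat \<Rightarrow> bool list" where
  "elias_gamma n = (let k = nat \<lfloor>log 2 (real n)\<rfloor> in replicate k False @ to_bits (k + 1) n)"

text \<open>
  The dictionary is the list of distinct chunks seen so far, in order of first appearance;
  a pointer is the 0-based position in that list.
\<close>

definition pointer :: "bool list list \<Rightarrow> bool list \<Rightarrow> bool list" where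
  "pointer dict c =
     to_bits (nat \<lceil>log 2 (real (length dict))\<rceil>) (LEAST i. i < length dict \<and> dict ! i = c)"

primrec encode_chunks :: "bool list list \<Rightarrow> bool list list \<Rightarrow> bool list" where
  "encode_chunks dict [] = []"
| "encode_chunks dict (c # cs) =
     (if c \<in> set dict
      then [False] @ pointer dict c @ encode_chunks dict cs
      else [True] @ c @ encode_chunks (dict @ [c]) cs)"

definition dict_encode :: "bool list list \<Rightarrow> bool list" where
  "dict_encode cs = elias_gamma (length (concat cs)) @ encode_chunks [] cs"

text \<open>Consecutive chunks of length \<open>l\<close>, the last one possibly shorter; meaningful for \<open>l > 0\<close>.\<close>

function chunks :: "nat \<Rightarrow> 'a list \<Rightarrow> 'a list list" where
  "chunks l xs = (if l = 0 \<or> xs = [] then [] else take l xs # chunks l (drop l xs))"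
  by auto
termination by (relation "Wellfounded.measure (length \<circ> snd)") auto

declare chunks.simps [simp del]

definition mFLD_parse :: "nat \<Rightarrow> nat \<Rightarrow> bool list \<Rightarrow> bool list list" where
  "mFLD_parse D l s = concat (map (chunks l) (chunks D s))"

definition mFLD_length :: "nat \<Rightarrow> nat \<Rightarrow> bool list \<Rightarrow> nat" where
  "mFLD_length D l s = length (dict_encode (mFLD_parse D l s))"

end

theory Submission
  imports Defs
begin

text \<open>
  Every chunk costs at least one bit, so chunks of length at most \<open>12\<close> already give
  \<open>BL/12\<close>. For longer chunks, fix a set \<open>G\<close> of strings of a length \<open>h \<le> l\<close> with
  \<open>log 2 (card G) \<ge> l/2 + 1\<close>. If the first half of the blocks produces chunks with at least a
  quarter of the strings in \<open>G\<close> as prefixes, the dictionary is so large that each of the at least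
  \<open>L/(2l)\<close> full chunks of every later block costs at least \<open>l/2\<close> bits. It is therefore enough that
  each string of \<open>G\<close> is missed by the first half with probability at most \<open>1/4\<close>.

  If \<open>l\<close> is below the entropy bound, \<open>G\<close> is the Hamming ball of radius \<open>l/2\<close> around the first chunk
  of the first source symbol: every block hits each of its elements with probability at least
  \<open>(\<delta> (1 - \<delta>)) powr (l/2) / A \<ge> 4/B\<close>. If \<open>l * 2 ^ l = O(AL)\<close>, \<open>G\<close> consists of all strings of
  length \<open>l div 2 + 2\<close>, which the uniform chunks of the \<open>A\<close> source symbols hit many times.
  The error term can thus be taken to vanish from some point on.
\<close>

subsection \<open>Chunks and encoding length\<close>

lemma chunks_append:
  assumes "length xs = l" "0 < l"
  shows "chunks l (xs @ ys) = xs # chunks l ys"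
  using assms by (subst chunks.simps) auto

lemma chunks_concat:
  assumes "\<forall>x\<in>set xss. length x = l" "0 < l"
  shows "chunks l (concat xss) = xss"
  using assms by (induction xss) (auto simp: chunks_append chunks.simps[of l "[]"])

lemma concat_chunks: "0 < l \<Longrightarrow> concat (chunks l xs) = xs"
proof (induction l xs rule: chunks.induct)
  case (1 l xs)
  then show ?case by (subst chunks.simps) auto
qed

lemma length_chunk_le: "c \<in> set (chunks l xs) \<Longrightarrow> length c \<le> l"
proof (induction l xs rule: chunks.induct)
  case (1 l xs)
  then show ?case by (subst (asm) (2) chunks.simps) (auto split: if_splits)
qed

lemma length_full_chunks:
  "0 < l \<Longrightarrow> length (filter (\<lambda>c. length c = l) (chunks l xs)) = length xs div l"
proof (induction l xs rule: chunks.induct)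
  case (1 l xs)
  show ?case
  proof (cases "length xs < l")
    case True
    then have "chunks l (drop l xs) = []" by (simp add: chunks.simps)
    then show ?thesis using True by (subst chunks.simps) auto
  next
    case False
    then have "length xs div l = Suc ((length xs - l) div l)"
      using 1 by (simp add: le_div_geq)
    then show ?thesis using False 1 by (subst chunks.simps) auto
  qed
qed

text \<open>The remainder \<open>L mod l\<close> is smaller than \<open>l\<close>, hence smaller
  than the part covered by full chunks, of which there is at least one.\<close>

lemma half_le_full_chunks:
  fixes l L :: nat
  assumes "0 < l" "l \<le> L"
  shows "real L / 2 \<le> real l * real (L div l)"
proof -
  have "l \<le> l * (L div l)" using assms by (simp add: Suc_leI div_greater_zero_iff)
  moreover have "L mod l < l" using assms by simp
  moreover have "L = l * (L div l) + L mod l" by simp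
  ultimately have "L \<le> 2 * (l * (L div l))" by linarith
  then have "real L \<le> real (2 * (l * (L div l)))" by (rule of_nat_mono)
  then show ?thesis by simp
qed

lemma length_to_bits [simp]: "length (to_bits w n) = w"
  by (simp add: to_bits_def)

text \<open>The dictionary is the only state of the encoder, so the cost of later chunks can be
  bounded separately. Its set of entries is recorded because this bounds its size from
  below.\<close>

lemma encode_chunks_append:
  "\<exists>dict'. set dict' = set dict \<union> set cs \<and>
     encode_chunks dict (cs @ ds) = encode_chunks dict cs @ encode_chunks dict' ds"
proof (induction cs arbitrary: dict)
  case (Cons c cs)
  show ?case
  proof (cases "c \<in> set dict")
    case True
    with Cons[of dict] show ?thesis by auto
  next
    case False
    with Cons[of "dict @ [c]"] show ?thesis by auto
  qed
qed auto

lemma length_encode_chunks_ge: "length cs \<le> length (encode_chunks dict cs)"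
  by (induction cs arbitrary: dict) (auto simp: le_SucI trans_le_add2)

text \<open>A new full chunk costs \<open>l + 1\<close> bits and a repeated one a flag plus a
  pointer. The dictionary never shrinks, so the pointer bound survives the induction.\<close>

lemma length_encode_chunks_ge_full:
  assumes "dict \<noteq> []" "K \<le> real l + 1" "K \<le> 1 + log 2 (length dict)"
  shows "K * length (filter (\<lambda>c. length c = l) cs) \<le> length (encode_chunks dict cs)"
  using assms
proof (induction cs arbitrary: dict)
  case (Cons c cs)
  show ?case
  proof (cases "c \<in> set dict")
    case True
    have "K \<le> 1 + real (nat \<lceil>log 2 (real (length dict))\<rceil>)"
      using Cons.prems(3) by linarith
    with Cons.IH[OF Cons.prems] True show ?thesis
      by (auto simp: pointer_def algebra_simps)
  next
    case False
    have "log 2 (length dict) \<le> log 2 (length (dict @ [c]))"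
      using Cons.prems(1) by (subst log_le_cancel_iff) auto
    then have "K \<le> 1 + log 2 (length (dict @ [c]))"
      using Cons.prems(3) by linarith
    then have "K * length (filter (\<lambda>c. length c = l) cs) \<le> length (encode_chunks (dict @ [c]) cs)"
      by (intro Cons.IH Cons.prems(2)) auto
    with False Cons.prems(2) show ?thesis
      by (auto simp: algebra_simps)
  qed
qed simp

section \<open>Lower bounds on the encoding length of a fixed stream\<close>

lemma mFLD_parse_concat:
  assumes "\<forall>y\<in>set Ys. length y = L" "0 < L"
  shows "mFLD_parse L l (concat Ys) = concat (map (chunks l) Ys)"
  using chunks_concat[OF assms] by (simp add: mFLD_parse_def)

text \<open>Each chunk covers at most \<open>l\<close> symbols of the stream and costs at least its
  flag bit.\<close>

lemma mFLD_length_ge_chunk_count: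
  assumes "\<forall>y\<in>set Ys. length y = L" "0 < L" "0 < l"
  shows "length Ys * L \<le> l * mFLD_length L l (concat Ys)"
proof -
  define cs where "cs = mFLD_parse L l (concat Ys)"
  have cs: "cs = concat (map (chunks l) Ys)"
    unfolding cs_def by (rule mFLD_parse_concat[OF assms(1,2)])
  have "length (concat ds) \<le> l * length ds" if "\<forall>c\<in>set ds. length c \<le> l" for ds :: "bool list list"
    using that by (induction ds) auto
  moreover have "\<forall>c\<in>set cs. length c \<le> l"
    unfolding cs using length_chunk_le by auto
  ultimately have "length (concat cs) \<le> l * length cs" by blast
  moreover have "length (concat cs) = length Ys * L"
    unfolding cs using assms(1) by (induction Ys) (auto simp: concat_chunks[OF assms(3)])
  moreover have "length cs \<le> mFLD_length L l (concat Ys)"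
    using length_encode_chunks_ge[of cs "[]"]
    by (simp add: mFLD_length_def dict_encode_def cs_def)
  ultimately show ?thesis
    by (metis mult_le_mono2 order_trans)
qed

text \<open>Prefixes serve both choices of target strings: for \<open>length y = l\<close> this is
  equality with a full chunk, while shorter \<open>y\<close> are counted by any chunk that extends
  them. A chunk shorter than \<open>y\<close> never matches.\<close>

definition has_chunk_prefix :: "nat \<Rightarrow> bool list \<Rightarrow> bool list \<Rightarrow> bool" where
  "has_chunk_prefix l y x \<longleftrightarrow> y \<in> take (length y) ` set (chunks l x)"

text \<open>Distinct strings of the common length \<open>h\<close> are prefixes of distinct chunks,
  so after \<open>n\<close> blocks the dictionary has at least \<open>card N\<close> entries. Only
  the full chunks of the later blocks are charged.\<close>

lemma mFLD_length_ge_dictionary: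
  assumes len: "\<forall>y\<in>set Ys. length y = L" "0 < L" "0 < l"
    and N: "N \<subseteq> {y. length y = h \<and> (\<exists>x\<in>set (take n Ys). has_chunk_prefix l y x)}"
      "N \<noteq> {}"
    and K: "K \<le> real l + 1" "K \<le> 1 + log 2 (card N)"
  shows "K * (real (length Ys - n) * real (L div l)) \<le> mFLD_length L l (concat Ys)"
proof -
  define cs where "cs = concat (map (chunks l) (take n Ys))"
  define ds where "ds = concat (map (chunks l) (drop n Ys))"
  obtain dict where dict: "set dict = set cs"
      "encode_chunks [] (cs @ ds) = encode_chunks [] cs @ encode_chunks dict ds"
    using encode_chunks_append[of "[]" cs ds] by auto
  have parse: "mFLD_parse L l (concat Ys) = cs @ ds"
    unfolding mFLD_parse_concat[OF len(1,2)] cs_def ds_def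
    by (metis append_take_drop_id concat_append map_append)
  have "N \<subseteq> take h ` set cs"
    using N(1) unfolding cs_def has_chunk_prefix_def by fastforce
  then have "card N \<le> card (set cs)"
    by (meson List.finite_set card_image_le card_mono finite_imageI order_trans)
  also have "\<dots> \<le> length dict"
    using dict(1) card_length by metis
  finally have card: "card N \<le> length dict" .
  have "finite N"
    using \<open>N \<subseteq> take h ` set cs\<close> finite_subset by blast
  then have pos: "0 < card N" using N(2) by (simp add: card_gt_0_iff)
  have "log 2 (card N) \<le> log 2 (length dict)"
    using card pos by (subst log_le_cancel_iff) auto
  then have enc: "K * length (filter (\<lambda>c. length c = l) ds) \<le> length (encode_chunks dict ds)"
    using card pos K by (intro length_encode_chunks_ge_full) auto
  have "length (filter (\<lambda>c. length c = l) (concat (map (chunks l) Zs))) = length Zs * (L div l)"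
    if "\<forall>y\<in>set Zs. length y = L" for Zs :: "bool list list"
    using that by (induction Zs) (auto simp: length_full_chunks[OF len(3)])
  moreover have "\<forall>y\<in>set (drop n Ys). length y = L"
    using len(1) by (meson in_set_dropD)
  ultimately have "length (filter (\<lambda>c. length c = l) ds) = (length Ys - n) * (L div l)"
    unfolding ds_def by (metis length_drop)
  with enc have "K * (real (length Ys - n) * real (L div l)) \<le> length (encode_chunks dict ds)"
    by simp
  also have "\<dots> \<le> mFLD_length L l (concat Ys)"
    by (simp add: mFLD_length_def dict_encode_def parse dict(2))
  finally show ?thesis .
qed

text \<open>A linear lower bound for the step function of the number of hits, so that only the
  expected number of misses is needed.\<close>

lemma mFLD_length_ge_misses:
  assumes len: "\<forall>y\<in>set Ys. length y = L" "0 < L" "0 < l"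
    and G: "finite G" "G \<noteq> {}" "\<forall>y\<in>G. length y = h"
    and K: "0 \<le> K" "K \<le> real l + 1" "K \<le> log 2 (card G) - 1"
  shows "K * (real (length Ys - n) * real (L div l)) *
      (1 - 4 / 3 * ((\<Sum>y\<in>G. of_bool (\<forall>x\<in>set (take n Ys). \<not> has_chunk_prefix l y x)) / card G))
    \<le> mFLD_length L l (concat Ys)"
proof -
  define U where "U = {y\<in>G. \<forall>x\<in>set (take n Ys). \<not> has_chunk_prefix l y x}"
  have g: "0 < card G" using G by (simp add: card_gt_0_iff)
  have U: "(\<Sum>y\<in>G. of_bool (\<forall>x\<in>set (take n Ys). \<not> has_chunk_prefix l y x)) = real (card U)"
    using G(1) by (simp add: U_def of_bool_def sum.If_cases Int_def)
  have "U \<subseteq> G" by (auto simp: U_def)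
  have card: "card (G - U) = card G - card U" "card U \<le> card G"
    using G(1) \<open>U \<subseteq> G\<close> by (auto simp: card_Diff_subset finite_subset card_mono)
  define M where "M = K * (real (length Ys - n) * real (L div l))"
  have M: "0 \<le> M" using K(1) by (simp add: M_def)
  show ?thesis
  \<comment> \<open>The factor \<open>4 / 3\<close> makes the left side vanish when exactly three
    quarters of \<open>G\<close> are missed. With more misses it is nonpositive; otherwise at least
    a quarter of \<open>G\<close> is hit, which costs 2 in the logarithm.\<close>
  proof (cases "4 * card (G - U) < card G")
    case True
    then have "3 * real (card G) \<le> 4 * real (card U)"
      using card by linarith
    then have "1 - 4 / 3 * (real (card U) / card G) \<le> 0"
      using g by (simp add: field_simps)
    then have "M * (1 - 4 / 3 * (real (card U) / card G)) \<le> 0"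
      using M by (simp add: mult_nonneg_nonpos)
    then show ?thesis unfolding U M_def[symmetric] by linarith
  next
    case False
    then have pos: "0 < card (G - U)" using g by linarith
    have "log 2 (card G) - 2 = log 2 (real (card G) / 4)"
      using g log_of_power_eq[of 4 2 2] by (simp add: log_divide)
    also have "\<dots> \<le> log 2 (card (G - U))"
      using False g pos by (subst log_le_cancel_iff) auto
    finally have "K \<le> 1 + log 2 (card (G - U))" using K(3) by linarith
    moreover have "G - U \<noteq> {}" using pos by force
    moreover have "G - U \<subseteq> {y. length y = h \<and> (\<exists>x\<in>set (take n Ys). has_chunk_prefix l y x)}"
      using G(3) by (auto simp: U_def)
    ultimately have "M \<le> mFLD_length L l (concat Ys)"
      unfolding M_def by (intro mFLD_length_ge_dictionary[OF len _ _ K(2)])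
    moreover have "M * (1 - 4 / 3 * (real (card U) / card G)) \<le> M"
      using M by (intro mult_left_le) auto
    ultimately show ?thesis unfolding U M_def[symmetric] by linarith
  qed
qed

subsection \<open>Expectations over finite distributions\<close>

text \<open>All distributions that occur have finite support, so conditioning is a finite sum and
  integrability is automatic.\<close>

lemma expectation_bind_finite:
  fixes h :: "'b \<Rightarrow> real"
  assumes "finite (set_pmf p)" "\<And>x. x \<in> set_pmf p \<Longrightarrow> finite (set_pmf (f x))"
  shows "measure_pmf.expectation (p \<bind> f) h =
    measure_pmf.expectation p (\<lambda>x. measure_pmf.expectation (f x) h)"
proof -
  have "measure_pmf.expectation (p \<bind> f) h =
      (\<Sum>a\<in>set_pmf p. pmf p a *\<^sub>R measure_pmf.expectation (f a) h)"
    using assms by (intro pmf_expectation_bind) auto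
  also have "\<dots> = measure_pmf.expectation p (\<lambda>x. measure_pmf.expectation (f x) h)"
    using assms(1) by (intro integral_measure_pmf[symmetric]) auto
  finally show ?thesis .
qed

lemma expectation_mono_finite:
  fixes f g :: "'a \<Rightarrow> real"
  assumes "finite (set_pmf p)" "\<And>x. x \<in> set_pmf p \<Longrightarrow> f x \<le> g x"
  shows "measure_pmf.expectation p f \<le> measure_pmf.expectation p g"
  using assms by (intro integral_mono_AE integrable_measure_pmf_finite) (auto simp: AE_measure_pmf_iff)

lemma finite_set_replicate_pmf:
  assumes "finite (set_pmf p)"
  shows "finite (set_pmf (replicate_pmf n p))"
proof -
  have "set_pmf (replicate_pmf n p) \<subseteq> {xs. set xs \<subseteq> set_pmf p \<and> length xs = n}"
    by (auto simp: set_replicate_pmf)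
  then show ?thesis using finite_lists_length_eq[OF assms] finite_subset by blast
qed

text \<open>This is the form in which independence enters: with indicator factors for the event that
  all blocks miss a string, and with exponential factors for the symbols.\<close>

lemma expectation_prod_list_replicate:
  fixes f :: "'a \<Rightarrow> real"
  assumes "finite (set_pmf p)"
  shows "measure_pmf.expectation (replicate_pmf n p) (\<lambda>xs. prod_list (map f xs)) =
    measure_pmf.expectation p f ^ n"
proof (induction n)
  case (Suc n)
  have "measure_pmf.expectation (replicate_pmf (Suc n) p) (\<lambda>xs. prod_list (map f xs)) =
    measure_pmf.expectation p (\<lambda>x. measure_pmf.expectation (replicate_pmf n p)
      (\<lambda>xs. f x * prod_list (map f xs)))"
    using assms finite_set_replicate_pmf[OF assms]
    by (simp add: expectation_bind_finite)
  also have "\<dots> = measure_pmf.expectation p f ^ Suc n"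
    using Suc by simp
  finally show ?case .
qed simp

lemma map_take_replicate_pmf:
  "n \<le> m \<Longrightarrow> map_pmf (take n) (replicate_pmf m p) = replicate_pmf n p"
proof (induction m arbitrary: n)
  case (Suc m)
  show ?case
  proof (cases n)
    case 0
    then show ?thesis by (simp add: map_pmf_const)
  next
    case (Suc k)
    have "map_pmf (take n) (replicate_pmf (Suc m) p) =
        do {x \<leftarrow> p; xs \<leftarrow> map_pmf (take k) (replicate_pmf m p); return_pmf (x # xs)}"
      by (simp add: Suc map_bind_pmf bind_map_pmf)
    also have "\<dots> = replicate_pmf n p"
      using Suc.IH[of k] Suc.prems Suc by simp
    finally show ?thesis .
  qed
qed simp

lemma prod_list_of_bool: "prod_list (map (\<lambda>x. of_bool (P x)) xs) = (of_bool (\<forall>x\<in>set xs. P x) :: real)"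
  by (induction xs) auto

text \<open>The indicator is a product of indicators, and the first \<open>n\<close> of
  \<open>m\<close> independent draws are distributed as \<open>n\<close> independent draws.\<close>

lemma expectation_all_take_replicate:
  assumes "finite (set_pmf p)" "n \<le> m"
  shows "measure_pmf.expectation (replicate_pmf m p) (\<lambda>xs. of_bool (\<forall>x\<in>set (take n xs). P x) :: real) =
    measure_pmf.expectation p (\<lambda>x. of_bool (P x)) ^ n"
proof -
  have "measure_pmf.expectation (replicate_pmf m p) (\<lambda>xs. of_bool (\<forall>x\<in>set (take n xs). P x) :: real) =
    measure_pmf.expectation (map_pmf (take n) (replicate_pmf m p))
      (\<lambda>xs. prod_list (map (\<lambda>x. of_bool (P x)) xs))"
    by (simp add: prod_list_of_bool)
  also have "\<dots> = measure_pmf.expectation p (\<lambda>x. of_bool (P x)) ^ n"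
    unfolding map_take_replicate_pmf[OF assms(2)]
    by (rule expectation_prod_list_replicate[OF assms(1)])
  finally show ?thesis .
qed

text \<open>The bound for a fixed stream is affine in the miss indicators, so linearity of
  expectation and independence of the blocks give powers of single-block miss probabilities.\<close>

lemma expectation_mFLD_length_ge_misses:
  assumes p: "finite (set_pmf p)" "\<And>y. y \<in> set_pmf p \<Longrightarrow> length y = L"
    and pos: "0 < L" "0 < l" and n: "n \<le> B"
    and G: "finite G" "G \<noteq> {}" "\<forall>y\<in>G. length y = h"
    and K: "0 \<le> K" "K \<le> real l + 1" "K \<le> log 2 (card G) - 1"
  shows "K * (real (B - n) * real (L div l)) * (1 - 4 / 3 *
      ((\<Sum>y\<in>G. measure_pmf.expectation p (\<lambda>x. of_bool (\<not> has_chunk_prefix l y x)) ^ n) / card G))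
    \<le> measure_pmf.expectation (replicate_pmf B p) (\<lambda>Ys. real (mFLD_length L l (concat Ys)))"
proof -
  define M where "M = K * (real (B - n) * real (L div l))"
  note fin = finite_set_replicate_pmf[OF p(1), of B]
  note int = integrable_measure_pmf_finite[OF fin]
  have "measure_pmf.expectation (replicate_pmf B p) (\<lambda>Ys. M * (1 - 4 / 3 *
      ((\<Sum>y\<in>G. of_bool (\<forall>x\<in>set (take n Ys). \<not> has_chunk_prefix l y x)) / card G)))
    \<le> measure_pmf.expectation (replicate_pmf B p) (\<lambda>Ys. real (mFLD_length L l (concat Ys)))"
  proof (rule expectation_mono_finite[OF fin])
    fix Ys assume "Ys \<in> set_pmf (replicate_pmf B p)"
    then have "\<forall>y\<in>set Ys. length y = L" "length Ys = B"
      using p(2) by (auto simp: set_replicate_pmf)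
    then show "M * (1 - 4 / 3 *
      ((\<Sum>y\<in>G. of_bool (\<forall>x\<in>set (take n Ys). \<not> has_chunk_prefix l y x)) / card G))
      \<le> mFLD_length L l (concat Ys)"
      using mFLD_length_ge_misses[of Ys L l G h K n] pos G K by (simp add: M_def)
  qed
  moreover have "measure_pmf.expectation (replicate_pmf B p) (\<lambda>Ys. M * (1 - 4 / 3 *
      ((\<Sum>y\<in>G. of_bool (\<forall>x\<in>set (take n Ys). \<not> has_chunk_prefix l y x)) / card G))) =
    M * (1 - 4 / 3 *
      ((\<Sum>y\<in>G. measure_pmf.expectation p (\<lambda>x. of_bool (\<not> has_chunk_prefix l y x)) ^ n) / card G))"
    by (simp add: int expectation_all_take_replicate[OF p(1) n])
  ultimately show ?thesis unfolding M_def by (simp only:)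
qed

subsection \<open>The edit channel\<close>

lemma length_edit_pmf: "y \<in> set_pmf (edit_pmf \<delta> x) \<Longrightarrow> length y = length x"
  by (induction x arbitrary: y) auto

lemma finite_set_edit_pmf: "finite (set_pmf (edit_pmf \<delta> x))"
proof -
  have "set_pmf (edit_pmf \<delta> x) \<subseteq> {y. set y \<subseteq> UNIV \<and> length y = length x}"
    by (auto dest: length_edit_pmf)
  then show ?thesis by (rule finite_subset) (rule finite_lists_length_eq, simp)
qed

fun hamming :: "bool list \<Rightarrow> bool list \<Rightarrow> nat" where
  "hamming (x # xs) (y # ys) = (if x = y then 0 else 1) + hamming xs ys"
| "hamming _ _ = 0"

lemma hamming_le_length: "hamming x y \<le> length x"
  by (induction x y rule: hamming.induct) auto

lemma hamming_map_Not:
  "length x = length y \<Longrightarrow> hamming x (map Not y) = length x - hamming x y"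
proof (induction x y rule: list_induct2)
  case (Cons x xs y ys)
  then show ?case using hamming_le_length[of xs ys] by (simp add: Suc_diff_le)
qed simp

lemma pmf_map_Cons: "pmf (map_pmf ((#) a) q) (b # y) = (if a = b then pmf q y else 0)"
proof (cases "a = b")
  case True
  then show ?thesis by (simp add: pmf_map_inj')
next
  case False
  then have "b # y \<notin> set_pmf (map_pmf ((#) a) q)" by auto
  then show ?thesis using False by (simp add: pmf_eq_0_set_pmf)
qed

text \<open>The flips are independent: each disagreement contributes a factor
  \<open>\<delta>\<close>, each agreement a factor \<open>1 - \<delta>\<close>.\<close>

lemma pmf_edit_pmf:
  assumes "0 \<le> \<delta>" "\<delta> \<le> 1" "length x = length y"
  shows "pmf (edit_pmf \<delta> x) y = \<delta> ^ hamming x y * (1 - \<delta>) ^ (length x - hamming x y)"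
  using assms(3)
proof (induction x y rule: list_induct2)
  case (Cons x xs y ys)
  have "edit_pmf \<delta> (x # xs) = do {flip \<leftarrow> bernoulli_pmf \<delta>; map_pmf ((#) (x \<noteq> flip)) (edit_pmf \<delta> xs)}"
    by (simp add: map_pmf_def)
  then have step: "pmf (edit_pmf \<delta> (x # xs)) (y # ys) =
      (if x = y then 1 - \<delta> else \<delta>) * pmf (edit_pmf \<delta> xs) ys"
    using assms(1,2) by (cases x; cases y) (simp_all add: pmf_bind pmf_map_Cons)
  have "Suc (length xs) - hamming xs ys = Suc (length xs - hamming xs ys)"
    using hamming_le_length[of xs ys] by (rule Suc_diff_le)
  then show ?case
    unfolding step Cons.IH by (cases "x = y") simp_all
qed simp

lemma map_take_edit_pmf: "map_pmf (take l) (edit_pmf \<delta> x) = edit_pmf \<delta> (take l x)"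
proof (induction x arbitrary: l)
  case (Cons x xs)
  show ?case
  proof (cases l)
    case 0
    then show ?thesis by (simp add: map_pmf_const)
  next
    case (Suc k)
    have "map_pmf (take l) (edit_pmf \<delta> (x # xs)) =
       do {flip \<leftarrow> bernoulli_pmf \<delta>; ys \<leftarrow> map_pmf (take k) (edit_pmf \<delta> xs);
         return_pmf ((x \<noteq> flip) # ys)}"
      by (simp add: Suc map_bind_pmf bind_map_pmf)
    then show ?thesis using Cons[of k] Suc by simp
  qed
qed simp

lemma pmf_replicate_coin:
  "pmf (replicate_pmf L (pmf_of_set (UNIV :: bool set))) xs = (if length xs = L then 1 / 2 ^ L else 0)"
proof (induction L arbitrary: xs)
  case (Suc L)
  let ?u = "replicate_pmf L (pmf_of_set (UNIV :: bool set))"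
  have eq: "replicate_pmf (Suc L) (pmf_of_set (UNIV :: bool set)) =
      pmf_of_set UNIV \<bind> (\<lambda>x. map_pmf ((#) x) ?u)"
    by (simp add: map_pmf_def)
  show ?case
  proof (cases xs)
    case Nil
    have "pmf (map_pmf ((#) x) ?u) [] = 0" for x
      by (auto simp: pmf_eq_0_set_pmf)
    then show ?thesis using Nil by (simp only: eq pmf_bind) simp
  next
    case (Cons y ys)
    have "pmf (pmf_of_set UNIV \<bind> (\<lambda>x. map_pmf ((#) x) ?u)) (y # ys) = pmf ?u ys / 2"
      by (cases y) (simp_all add: pmf_bind pmf_map_Cons integral_pmf_of_set UNIV_bool)
    then show ?thesis
      unfolding eq Cons Suc[of ys] by (cases "length ys = L") simp_all
  qed
qed auto

lemma finite_lists_length: "finite {xs :: bool list. length xs = L}"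
  using finite_lists_length_eq[of "UNIV :: bool set" L] by simp

lemma lists_length_nonempty: "{xs :: bool list. length xs = L} \<noteq> {}"
  by (auto intro: exI[of _ "replicate L True"])

text \<open>Writing a uniform string as independent coin tosses allows induction on its length and
  cutting it into independent chunks.\<close>

lemma pmf_of_set_length: "pmf_of_set {xs :: bool list. length xs = L} = replicate_pmf L (pmf_of_set UNIV)"
proof (rule pmf_eqI)
  fix xs :: "bool list"
  have "card {xs :: bool list. length xs = L} = 2 ^ L"
    using card_lists_length_eq[of "UNIV :: bool set" L] by simp
  then show "pmf (pmf_of_set {xs :: bool list. length xs = L}) xs =
      pmf (replicate_pmf L (pmf_of_set UNIV)) xs"
    using pmf_of_set[OF lists_length_nonempty finite_lists_length] by (simp add: pmf_replicate_coin indicator_def)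
qed

text \<open>A fair bit stays fair when it is flipped by an independent bit.\<close>

lemma edit_uniform_pmf:
  "pmf_of_set {xs :: bool list. length xs = L} \<bind> edit_pmf \<delta> = pmf_of_set {xs. length xs = L}"
  unfolding pmf_of_set_length
proof (induction L)
  case (Suc L)
  let ?c = "pmf_of_set (UNIV :: bool set)"
  let ?u = "replicate_pmf L ?c"
  have flip: "map_pmf (\<lambda>x. x \<noteq> b) ?c = ?c" for b
    by (rule map_pmf_of_set_bij_betw) (auto simp: bij_betw_def inj_on_def image_iff)
  have "replicate_pmf (Suc L) ?c \<bind> edit_pmf \<delta> =
     do {x \<leftarrow> ?c; xs \<leftarrow> ?u; b \<leftarrow> bernoulli_pmf \<delta>; ys \<leftarrow> edit_pmf \<delta> xs; return_pmf ((x \<noteq> b) # ys)}"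
    by (simp add: bind_assoc_pmf bind_return_pmf)
  \<comment> \<open>Drawing the flip before the tail puts the tail next to its edit, where the
    induction hypothesis applies.\<close>
  also have "\<dots> = do {x \<leftarrow> ?c; b \<leftarrow> bernoulli_pmf \<delta>; xs \<leftarrow> ?u; ys \<leftarrow> edit_pmf \<delta> xs;
      return_pmf ((x \<noteq> b) # ys)}"
    by (simp only: bind_commute_pmf[of ?u "bernoulli_pmf \<delta>"])
  also have "\<dots> = do {x \<leftarrow> ?c; b \<leftarrow> bernoulli_pmf \<delta>; ys \<leftarrow> ?u \<bind> edit_pmf \<delta>;
      return_pmf ((x \<noteq> b) # ys)}"
    by (simp add: bind_assoc_pmf)
  \<comment> \<open>For a fixed flip \<open>b\<close>, drawn first, the map from \<open>x\<close> to
    \<open>x \<noteq> b\<close> is a bijection of the bits.\<close>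
  also have "\<dots> = do {b \<leftarrow> bernoulli_pmf \<delta>; x \<leftarrow> ?c; ys \<leftarrow> ?u; return_pmf ((x \<noteq> b) # ys)}"
    unfolding Suc by (rule bind_commute_pmf)
  also have "\<dots> = do {b \<leftarrow> bernoulli_pmf \<delta>; x \<leftarrow> map_pmf (\<lambda>x. x \<noteq> b) ?c; ys \<leftarrow> ?u; return_pmf (x # ys)}"
    by (simp add: bind_map_pmf)
  also have "\<dots> = replicate_pmf (Suc L) ?c"
    unfolding flip by simp
  finally show ?case .
qed (simp add: bind_return_pmf)

subsection \<open>The source\<close>

lemma finite_set_source_block_pmf:
  assumes "Xs \<noteq> []"
  shows "finite (set_pmf (source_block_pmf \<delta> Xs))"
  using assms by (auto simp: source_block_pmf_def finite_set_edit_pmf lessThan_empty_iff)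

lemma length_source_block_pmf:
  assumes "Xs \<noteq> []" "\<forall>x\<in>set Xs. length x = L" "y \<in> set_pmf (source_block_pmf \<delta> Xs)"
  shows "length y = L"
  using assms by (auto simp: source_block_pmf_def lessThan_empty_iff dest!: length_edit_pmf)

lemma expectation_source_block_pmf:
  fixes f :: "bool list \<Rightarrow> real"
  assumes "Xs \<noteq> []"
  shows "measure_pmf.expectation (source_block_pmf \<delta> Xs) f =
    (\<Sum>j<length Xs. measure_pmf.expectation (edit_pmf \<delta> (Xs ! j)) f) / length Xs"
  using assms unfolding source_block_pmf_def
  by (subst expectation_bind_finite)
     (auto simp: integral_pmf_of_set finite_set_edit_pmf lessThan_empty_iff)

lemma set_source_symbols_pmf:
  "set_pmf (source_symbols_pmf A L) = {Xs. length Xs = A \<and> (\<forall>x\<in>set Xs. length x = L)}"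
  by (auto simp: source_symbols_pmf_def set_replicate_pmf
      set_pmf_of_set[OF lists_length_nonempty finite_lists_length])

lemma finite_set_source_symbols_pmf: "finite (set_pmf (source_symbols_pmf A L))"
  unfolding source_symbols_pmf_def
  by (intro finite_set_replicate_pmf)
     (simp add: set_pmf_of_set[OF lists_length_nonempty finite_lists_length] finite_lists_length)

lemma expectation_source_pmf:
  fixes f :: "bool list \<Rightarrow> real"
  assumes "0 < A"
  shows "measure_pmf.expectation (source_pmf A B L \<delta>) f =
    measure_pmf.expectation (source_symbols_pmf A L) (\<lambda>Xs.
      measure_pmf.expectation (replicate_pmf B (source_block_pmf \<delta> Xs)) (\<lambda>Ys. f (concat Ys)))"
proof -
  have fin: "finite (set_pmf (replicate_pmf B (source_block_pmf \<delta> Xs)))"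
    if "Xs \<in> set_pmf (source_symbols_pmf A L)" for Xs
    using that assms
    by (intro finite_set_replicate_pmf finite_set_source_block_pmf) (auto simp: set_source_symbols_pmf)
  have "source_pmf A B L \<delta> = source_symbols_pmf A L \<bind>
      (\<lambda>Xs. map_pmf concat (replicate_pmf B (source_block_pmf \<delta> Xs)))"
    by (simp add: source_pmf_def map_pmf_def)
  then show ?thesis
    using fin by (simp add: expectation_bind_finite finite_set_source_symbols_pmf)
qed

lemma expectation_mFLD_length_ge_chunk_count:
  assumes "0 < A" "0 < L" "0 < l"
  shows "real B * real L / real l \<le>
    measure_pmf.expectation (source_pmf A B L \<delta>) (\<lambda>s. real (mFLD_length L l s))"
proof -
  have "real B * real L / real l \<le> mFLD_length L l (concat Ys)"
    if Xs: "Xs \<in> set_pmf (source_symbols_pmf A L)"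
      and Ys: "Ys \<in> set_pmf (replicate_pmf B (source_block_pmf \<delta> Xs))" for Xs Ys
  proof -
    have "Xs \<noteq> []" "\<forall>x\<in>set Xs. length x = L"
      using Xs assms(1) by (auto simp: set_source_symbols_pmf)
    from length_source_block_pmf[OF this]
    have "\<forall>y\<in>set Ys. length y = L" "length Ys = B"
      using Ys by (auto simp: set_replicate_pmf)
    then have "B * L \<le> l * mFLD_length L l (concat Ys)"
      using mFLD_length_ge_chunk_count[of Ys L l] assms by simp
    then have "real (B * L) \<le> real (l * mFLD_length L l (concat Ys))"
      by (rule of_nat_mono)
    then show ?thesis using assms(3) by (simp add: field_simps)
  qed
  then have "measure_pmf.expectation (source_symbols_pmf A L) (\<lambda>Xs.
      measure_pmf.expectation (replicate_pmf B (source_block_pmf \<delta> Xs)) (\<lambda>Ys. real B * real L / real l))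
    \<le> measure_pmf.expectation (source_pmf A B L \<delta>) (\<lambda>s. real (mFLD_length L l s))"
    unfolding expectation_source_pmf[OF assms(1)] using assms(1)
    by (intro expectation_mono_finite finite_set_source_symbols_pmf finite_set_replicate_pmf
        finite_set_source_block_pmf) (auto simp: set_source_symbols_pmf)
  then show ?thesis by simp
qed

text \<open>The symbols \<open>Xs\<close> are fixed because the blocks are independent only
  conditionally on them; \<open>n\<close> blocks then all miss \<open>y\<close> with the
  \<open>n\<close>-th power of this probability.\<close>

definition miss_prob :: "real \<Rightarrow> nat \<Rightarrow> bool list list \<Rightarrow> bool list \<Rightarrow> real" where
  "miss_prob \<delta> l Xs y =
     measure_pmf.expectation (source_block_pmf \<delta> Xs) (\<lambda>x. of_bool (\<not> has_chunk_prefix l y x))"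

text \<open>The first half of the blocks fills the dictionary; in the second half, with probability at
  least \<open>2/3\<close>, every full chunk costs at least \<open>l/2\<close> bits.\<close>

lemma expectation_mFLD_length_ge:
  fixes G :: "bool list list \<Rightarrow> bool list set"
  assumes pos: "0 < A" "0 < l" "l \<le> L"
    and G: "\<And>Xs. Xs \<in> set_pmf (source_symbols_pmf A L) \<Longrightarrow>
        finite (G Xs) \<and> G Xs \<noteq> {} \<and> (\<forall>y\<in>G Xs. length y = h) \<and>
        real l / 2 \<le> log 2 (card (G Xs)) - 1"
    and miss: "measure_pmf.expectation (source_symbols_pmf A L) (\<lambda>Xs.
        (\<Sum>y\<in>G Xs. miss_prob \<delta> l Xs y ^ (B div 2)) / card (G Xs)) \<le> 1 / 4"
  shows "1 / 12 * real B * real L \<le>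
    measure_pmf.expectation (source_pmf A B L \<delta>) (\<lambda>s. real (mFLD_length L l s))"
proof -
  define avg where "avg = (\<lambda>Xs. (\<Sum>y\<in>G Xs. miss_prob \<delta> l Xs y ^ (B div 2)) / card (G Xs))"
  define M where "M = real l / 2 * (real (B - B div 2) * real (L div l))"
  note fin = finite_set_source_symbols_pmf[of A L]
  note int = integrable_measure_pmf_finite[OF fin]
  have "measure_pmf.expectation (source_symbols_pmf A L) (\<lambda>Xs. M * (1 - 4 / 3 * avg Xs)) \<le>
    measure_pmf.expectation (source_pmf A B L \<delta>) (\<lambda>s. real (mFLD_length L l s))"
    unfolding expectation_source_pmf[OF pos(1)]
  proof (rule expectation_mono_finite[OF fin])
    fix Xs assume Xs: "Xs \<in> set_pmf (source_symbols_pmf A L)"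
    then have ne: "Xs \<noteq> []" "\<forall>x\<in>set Xs. length x = L"
      using pos(1) by (auto simp: set_source_symbols_pmf)
    show "M * (1 - 4 / 3 * avg Xs) \<le> measure_pmf.expectation
        (replicate_pmf B (source_block_pmf \<delta> Xs)) (\<lambda>Ys. real (mFLD_length L l (concat Ys)))"
      unfolding M_def avg_def miss_prob_def
      using G[OF Xs] pos
      by (intro expectation_mFLD_length_ge_misses[where h = h] finite_set_source_block_pmf ne(1)
          length_source_block_pmf[OF ne]) auto
  qed
  also have "measure_pmf.expectation (source_symbols_pmf A L) (\<lambda>Xs. M * (1 - 4 / 3 * avg Xs)) =
      M * (1 - 4 / 3 * measure_pmf.expectation (source_symbols_pmf A L) avg)"
    by (simp add: int)
  finally have le: "M * (1 - 4 / 3 * measure_pmf.expectation (source_symbols_pmf A L) avg) \<le>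
      measure_pmf.expectation (source_pmf A B L \<delta>) (\<lambda>s. real (mFLD_length L l s))" .
  have L: "real L / 2 \<le> real l * real (L div l)"
    by (rule half_le_full_chunks[OF pos(2,3)])
  have B: "real B / 2 \<le> real (B - B div 2)" by linarith
  have "real B / 2 * (real L / 2) \<le> real (B - B div 2) * (real l * real (L div l))"
    using L B by (intro mult_mono) auto
  \<comment> \<open>The three halves are \<open>l / 2\<close> bits per chunk, half of the blocks and
    the half of each block covered by full chunks. The factor \<open>2 / 3\<close>, which is
    \<open>1 - 4 / 3 * (1 / 4)\<close>, then turns \<open>1 / 8\<close> into
    \<open>1 / 12\<close>.\<close>
  then have "real B * real L / 8 \<le> M"
    by (simp add: M_def mult_ac)
  moreover have "2 / 3 \<le> 1 - 4 / 3 * measure_pmf.expectation (source_symbols_pmf A L) avg"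
    using miss unfolding avg_def by linarith
  ultimately have "real B * real L / 8 * (2 / 3) \<le>
      M * (1 - 4 / 3 * measure_pmf.expectation (source_symbols_pmf A L) avg)"
    by (intro mult_mono) (auto simp: M_def)
  with le show ?thesis by simp
qed

subsection \<open>Chunks no longer than the entropy bound\<close>

lemma expectation_neq: "measure_pmf.expectation p (\<lambda>x. of_bool (x \<noteq> y)) = 1 - pmf p y"
proof -
  have "measure_pmf.expectation p (\<lambda>x. of_bool (x \<noteq> y)) =
      measure_pmf.expectation p (indicat_real (UNIV - {y}))"
    by (intro Bochner_Integration.integral_cong) (auto simp: indicator_def)
  also have "\<dots> = measure_pmf.prob p (UNIV - {y})"
    by simp
  also have "\<dots> = 1 - measure_pmf.prob p {y}"
    using measure_pmf.prob_compl[of "{y}" p] by simp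
  finally show ?thesis by (simp add: measure_pmf_single)
qed

lemma has_chunk_prefix_take:
  assumes "0 < l" "length y \<le> l" "take (length y) x = y" "x \<noteq> []"
  shows "has_chunk_prefix l y x"
proof -
  have "take l x \<in> set (chunks l x)"
    using assms(1,4) by (subst chunks.simps) auto
  moreover have "take (length y) (take l x) = y"
    using assms(2,3) by (simp add: min_def)
  ultimately show ?thesis unfolding has_chunk_prefix_def by (metis image_eqI)
qed

text \<open>The first symbol is chosen with probability \<open>1 / length Xs\<close>, and its edit
  then begins with the chunk \<open>y\<close> with the stated probability. For all other symbols the
  miss probability is bounded by 1.\<close>

lemma miss_prob_le:
  assumes "Xs \<noteq> []" "0 < l" "length y = l" "l \<le> length (Xs ! 0)"
  shows "miss_prob \<delta> l Xs y \<le> 1 - pmf (edit_pmf \<delta> (take l (Xs ! 0))) y / length Xs"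
proof -
  define f where "f j = measure_pmf.expectation (edit_pmf \<delta> (Xs ! j))
    (\<lambda>x. of_bool (\<not> has_chunk_prefix l y x) :: real)" for j
  have "f j \<le> measure_pmf.expectation (edit_pmf \<delta> (Xs ! j)) (\<lambda>x. 1)" for j
    unfolding f_def by (intro expectation_mono_finite finite_set_edit_pmf) auto
  then have f1: "f j \<le> 1" for j by simp
  have "f 0 \<le> measure_pmf.expectation (edit_pmf \<delta> (Xs ! 0)) (\<lambda>x. of_bool (take l x \<noteq> y))"
    unfolding f_def
  proof (intro expectation_mono_finite finite_set_edit_pmf)
    fix x assume "x \<in> set_pmf (edit_pmf \<delta> (Xs ! 0))"
    from length_edit_pmf[OF this] have "x \<noteq> []" using assms by auto
    then show "of_bool (\<not> has_chunk_prefix l y x) \<le> (of_bool (take l x \<noteq> y) :: real)"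
      using has_chunk_prefix_take[of l y x] assms by auto
  qed
  also have "\<dots> = measure_pmf.expectation (map_pmf (take l) (edit_pmf \<delta> (Xs ! 0))) (\<lambda>x. of_bool (x \<noteq> y))"
    by simp
  also have "\<dots> = 1 - pmf (edit_pmf \<delta> (take l (Xs ! 0))) y"
    unfolding map_take_edit_pmf by (rule expectation_neq)
  finally have f0: "f 0 \<le> 1 - pmf (edit_pmf \<delta> (take l (Xs ! 0))) y" .
  obtain a where a: "length Xs = Suc a"
    using assms(1) by (cases Xs) auto
  have "(\<Sum>j<length Xs. f j) = f 0 + (\<Sum>j<a. f (Suc j))"
    unfolding a by (rule sum.lessThan_Suc_shift)
  also have "\<dots> \<le> (1 - pmf (edit_pmf \<delta> (take l (Xs ! 0))) y) + (\<Sum>j<a. 1)"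
    by (intro add_mono f0 sum_mono f1)
  finally have "(\<Sum>j<length Xs. f j) / length Xs \<le>
      (real (length Xs) - pmf (edit_pmf \<delta> (take l (Xs ! 0))) y) / length Xs"
    by (intro divide_right_mono) (auto simp: a)
  then show ?thesis
    using assms(1) unfolding miss_prob_def expectation_source_block_pmf[OF assms(1)] f_def
    by (simp add: diff_divide_distrib)
qed

text \<open>Of a string and its complement, at least one lies within distance \<open>l / 2\<close>
  of \<open>x\<close>.\<close>

lemma card_half_hamming_ball:
  assumes "length x = l"
  shows "2 ^ l \<le> 2 * card {y. length y = l \<and> 2 * hamming x y \<le> l}"
proof -
  let ?G = "{y. length y = l \<and> 2 * hamming x y \<le> l}"
  have fin: "finite ?G"
    by (rule finite_subset[OF _ finite_lists_length[of l]]) auto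
  have "{y. length y = l} \<subseteq> ?G \<union> map Not ` ?G"
  proof
    fix y :: "bool list" assume "y \<in> {y. length y = l}"
    then have y: "length y = l" by simp
    show "y \<in> ?G \<union> map Not ` ?G"
    proof (cases "2 * hamming x y \<le> l")
      case False
      then have "map Not y \<in> ?G"
        using y assms hamming_map_Not[of x y] by simp
      moreover have "y = map Not (map Not y)" by (simp add: comp_def)
      ultimately show ?thesis by blast
    qed (use y in simp)
  qed
  then have "card {y :: bool list. length y = l} \<le> card (?G \<union> map Not ` ?G)"
    using fin by (intro card_mono) auto
  also have "\<dots> \<le> card ?G + card (map Not ` ?G)" by (rule card_Un_le)
  also have "\<dots> \<le> 2 * card ?G" using card_image_le[OF fin, of "map Not"] by simp
  finally show ?thesis using card_lists_length_eq[of "UNIV :: bool set" l] by simp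
qed

text \<open>Since \<open>\<delta> < 1 - \<delta>\<close>, the probability is smallest when half of
  the bits are flipped. Squaring avoids the exponent \<open>l / 2\<close>, which need not be an
  integer.\<close>

lemma pmf_edit_pmf_ge:
  assumes "0 < \<delta>" "\<delta> < 1 / 2" "length x = l" "length y = l" "2 * hamming x y \<le> l"
  shows "(\<delta> * (1 - \<delta>)) ^ l \<le> pmf (edit_pmf \<delta> x) y ^ 2"
proof -
  define d where "d = hamming x y"
  define k where "k = l - 2 * d"
  have l: "l = 2 * d + k" using assms(5) by (simp add: d_def k_def)
  have "\<delta> * (1 - \<delta>) \<le> (1 - \<delta>) ^ 2"
    using assms(1,2) by (simp add: power2_eq_square mult_right_mono)
  then have "(\<delta> * (1 - \<delta>)) ^ k \<le> ((1 - \<delta>) ^ 2) ^ k"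
    using assms(1,2) by (intro power_mono) auto
  then have "(\<delta> * (1 - \<delta>)) ^ (2 * d) * (\<delta> * (1 - \<delta>)) ^ k \<le>
      (\<delta> * (1 - \<delta>)) ^ (2 * d) * ((1 - \<delta>) ^ 2) ^ k"
    using assms(1,2) by (intro mult_left_mono) auto
  also have "\<dots> = (\<delta> ^ d * (1 - \<delta>) ^ (d + k)) ^ 2"
    by (simp add: power_mult_distrib power_mult[symmetric] power_add mult_ac)
  also have "\<dots> = pmf (edit_pmf \<delta> x) y ^ 2"
    using assms by (simp add: pmf_edit_pmf d_def[symmetric] l mult_2)
  finally show ?thesis by (simp add: l power_add)
qed

text \<open>Hence \<open>l\<close> times this entropy is the negative logarithm of
  \<open>(\<delta> * (1 - \<delta>)) powr (l / 2)\<close>, the bound on the probability of a string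
  in the Hamming ball.\<close>

lemma cross_entropy_half:
  assumes "0 < \<delta>" "\<delta> < 1"
  shows "cross_entropy (1 / 2) \<delta> = - (1 / 2) * log 2 (\<delta> * (1 - \<delta>))"
  using assms by (simp add: cross_entropy_def log_divide log_mult add_divide_distrib)

lemma expectation_mFLD_length_ge_short_chunks:
  assumes pos: "0 < A" "4 \<le> l" "l \<le> L" "0 < B" and \<delta>: "0 < \<delta>" "\<delta> < 1 / 2"
    and l: "real l \<le> (log 2 (real B / real A) - 2) / cross_entropy (1 / 2) \<delta>"
  shows "1 / 12 * real B * real L \<le>
    measure_pmf.expectation (source_pmf A B L \<delta>) (\<lambda>s. real (mFLD_length L l s))"
proof -
  define t where "t = \<delta> * (1 - \<delta>)"
  have "0 \<le> (\<delta> - 1 / 2) ^ 2" by simp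
  then have t: "0 < t" "t \<le> 1 / 4"
    using \<delta> by (simp_all add: t_def power2_eq_square algebra_simps)
  have H: "cross_entropy (1 / 2) \<delta> = - (1 / 2) * log 2 t"
    using \<delta> by (simp add: cross_entropy_half t_def)
  have "log 2 t \<le> log 2 (2 powr - 2)"
    using t by (subst log_le_cancel_iff) (auto simp: powr_minus)
  then have H1: "1 \<le> cross_entropy (1 / 2) \<delta>" unfolding H by simp
  have lH: "real l * cross_entropy (1 / 2) \<delta> \<le> log 2 (real B / real A) - 2"
    using l H1 by (simp add: pos_le_divide_eq)
  \<comment> \<open>With entropy at least 1 and \<open>l\<close> at least 4, the hypothesis on
    \<open>l\<close> forces \<open>log 2 (B / A)\<close> to be at least 6. So \<open>B\<close> is at
    least 64, which absorbs the rounding in \<open>B div 2\<close> below.\<close>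
  have "4 * 1 \<le> real l * cross_entropy (1 / 2) \<delta>"
    using pos(2) H1 by (intro mult_mono) auto
  then have "log 2 64 \<le> log 2 (real B / real A)"
    using lH log_of_power_eq[of 64 2 6] by simp
  then have "64 \<le> real B / real A"
    using pos by (subst (asm) log_le_cancel_iff) auto
  also have "\<dots> \<le> real B" using pos by (simp add: field_simps)
  finally have B: "64 \<le> real B" .
  \<comment> \<open>This is the entropy bound in exponential form: every string of the ball has
    probability at least \<open>4 * A / B\<close> under an edit of the first symbol's chunk.\<close>
  have "log 2 ((4 * real A / real B) ^ 2) = 2 * (2 - log 2 (real B / real A))"
    using pos log_of_power_eq[of 4 2 2] by (simp add: log_nat_power log_divide log_mult)
  also have "\<dots> \<le> log 2 (t ^ l)"
    using lH t unfolding H by (simp add: log_nat_power)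
  finally have q2: "(4 * real A / real B) ^ 2 \<le> t ^ l"
    using pos t by (subst (asm) log_le_cancel_iff) auto

  define G where "G = (\<lambda>Xs. {y. length y = l \<and> 2 * hamming (take l (Xs ! 0)) y \<le> l})"
  have fin: "finite (G Xs)" for Xs
    unfolding G_def by (rule finite_subset[OF _ finite_lists_length[of l]]) auto
  have symb: "Xs \<noteq> [] \<and> length Xs = A \<and> length (Xs ! 0) = L"
    if "Xs \<in> set_pmf (source_symbols_pmf A L)" for Xs
    using that pos(1) by (auto simp: set_source_symbols_pmf)
  have small: "miss_prob \<delta> l Xs y ^ (B div 2) \<le> 1 / 4"
    if Xs: "Xs \<in> set_pmf (source_symbols_pmf A L)" and y: "y \<in> G Xs" for Xs y
  proof -
    let ?p = "pmf (edit_pmf \<delta> (take l (Xs ! 0))) y"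
    note X = symb[OF Xs]
    have "t ^ l \<le> ?p ^ 2"
      unfolding t_def using y X pos \<delta> by (intro pmf_edit_pmf_ge) (auto simp: G_def)
    then have "4 * real A / real B \<le> ?p"
      using q2 by (intro power2_le_imp_le[OF _ pmf_nonneg]) linarith
    then have "4 / real B \<le> ?p / real A"
      using pos by (simp add: field_simps)
    moreover have "miss_prob \<delta> l Xs y \<le> 1 - ?p / real A"
      using miss_prob_le[of Xs l y \<delta>] X pos y by (auto simp: G_def)
    ultimately have "miss_prob \<delta> l Xs y \<le> 1 + - (4 / real B)" by linarith
    also have "\<dots> \<le> exp (- (4 / real B))" by (rule exp_ge_add_one_self)
    finally have "miss_prob \<delta> l Xs y ^ (B div 2) \<le> exp (- (4 / real B)) ^ (B div 2)"
      by (intro power_mono) (simp_all add: miss_prob_def)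
    also have "\<dots> = exp (- (4 * real (B div 2) / real B))"
      by (simp add: exp_of_nat_mult[symmetric] mult_ac)
    \<comment> \<open>For even \<open>B\<close> the exponent is \<open>-2\<close>; the value
      \<open>19 / 10\<close> leaves room for odd \<open>B\<close>, and \<open>exp (19 / 10)\<close>
      still exceeds 4.\<close>
    also have "\<dots> \<le> exp (- (19 / 10))"
    proof -
      have "real B \<le> 2 * real (B div 2) + 1" by linarith
      then have "19 / 10 * real B \<le> 4 * real (B div 2)" using B by linarith
      then show ?thesis using B by (simp add: field_simps)
    qed
    also have "\<dots> \<le> 1 / 4"
      using exp_lower_Taylor_quadratic[of "19 / 10"]
      by (simp add: exp_minus inverse_eq_divide field_simps power2_eq_square)
    finally show ?thesis .
  qed
  show ?thesis
  proof (rule expectation_mFLD_length_ge[where G = G and h = l])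
    fix Xs assume Xs: "Xs \<in> set_pmf (source_symbols_pmf A L)"
    have "2 ^ l \<le> 2 * card (G Xs)"
      unfolding G_def using symb[OF Xs] pos by (intro card_half_hamming_ball) simp
    then have "real (2 ^ l) \<le> real (2 * card (G Xs))" and card_pos: "0 < card (G Xs)"
      by (rule of_nat_mono) (use \<open>2 ^ l \<le> 2 * card (G Xs)\<close> in \<open>auto intro: gr0I\<close>)
    then have c: "2 ^ l / 2 \<le> real (card (G Xs))" by simp
    have "real l - 1 = log 2 (2 ^ l / 2)"
      by (simp add: log_divide)
    also have "\<dots> \<le> log 2 (card (G Xs))"
      using c card_pos by (subst log_le_cancel_iff) auto
    \<comment> \<open>The ball has at least \<open>2 ^ (l - 1)\<close> elements, and
      \<open>l - 2 \<ge> l / 2\<close> because \<open>l \<ge> 4\<close>.\<close>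
    finally have "real l / 2 \<le> log 2 (card (G Xs)) - 1"
      using pos(2) by linarith
    moreover have "G Xs \<noteq> {}"
      using card_pos by auto
    ultimately show "finite (G Xs) \<and> G Xs \<noteq> {} \<and> (\<forall>y\<in>G Xs. length y = l) \<and>
        real l / 2 \<le> log 2 (card (G Xs)) - 1"
      using fin by (auto simp: G_def)
  next
    have "measure_pmf.expectation (source_symbols_pmf A L) (\<lambda>Xs.
        (\<Sum>y\<in>G Xs. miss_prob \<delta> l Xs y ^ (B div 2)) / card (G Xs)) \<le>
      measure_pmf.expectation (source_symbols_pmf A L) (\<lambda>Xs. 1 / 4)"
    proof (rule expectation_mono_finite[OF finite_set_source_symbols_pmf])
      fix Xs assume Xs: "Xs \<in> set_pmf (source_symbols_pmf A L)"
      have "(\<Sum>y\<in>G Xs. miss_prob \<delta> l Xs y ^ (B div 2)) \<le> card (G Xs) * (1 / 4)"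
        by (rule sum_bounded_above[OF small[OF Xs]])
      then show "(\<Sum>y\<in>G Xs. miss_prob \<delta> l Xs y ^ (B div 2)) / card (G Xs) \<le> 1 / 4"
        by (cases "card (G Xs) = 0") (simp_all add: field_simps)
    qed
    then show "measure_pmf.expectation (source_symbols_pmf A L) (\<lambda>Xs.
        (\<Sum>y\<in>G Xs. miss_prob \<delta> l Xs y ^ (B div 2)) / card (G Xs)) \<le> 1 / 4"
      by simp
  qed (use pos in auto)
qed

subsection \<open>Few possible chunks\<close>

text \<open>An upper bound linear in \<open>r\<close> lets an expectation be taken inside, at the
  cost of a factor 2 in the exponent.\<close>

lemma exp_minus_le_linear:
  fixes r :: real
  assumes "0 \<le> r" "r \<le> 1"
  shows "exp (- r) \<le> 1 - r / 2"
proof -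
  have "r * r \<le> r * 1" using assms by (intro mult_left_mono) auto
  then have "1 \<le> (1 - r / 2) * (1 + r)" by (simp add: algebra_simps)
  also have "\<dots> \<le> (1 - r / 2) * exp r"
    using assms by (intro mult_left_mono exp_ge_add_one_self) auto
  finally show ?thesis by (simp add: exp_minus field_simps)
qed

lemma exp_minus_le_min:
  fixes z :: real
  assumes "0 \<le> z"
  shows "exp (- z) \<le> 1 - min 1 z / 2"
proof -
  have "exp (- z) \<le> exp (- min 1 z)" by simp
  also have "\<dots> \<le> 1 - min 1 z / 2"
    using assms by (intro exp_minus_le_linear) auto
  finally show ?thesis .
qed

lemma finite_set_coins: "finite (set_pmf (replicate_pmf L (pmf_of_set (UNIV :: bool set))))"
  by (intro finite_set_replicate_pmf) simp

text \<open>The first \<open>m\<close> chunks of a uniform string are independent and full, and each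
  starts with \<open>y\<close> with probability \<open>1 / 2 ^ length y\<close>. The induction
  splits off the first chunk.\<close>

lemma uniform_miss_prob_le:
  assumes "0 < l" "length y \<le> l" "m * l \<le> L"
  shows "measure_pmf.expectation (replicate_pmf L (pmf_of_set (UNIV :: bool set)))
    (\<lambda>x. of_bool (\<not> has_chunk_prefix l y x)) \<le> (1 - 1 / 2 ^ length y :: real) ^ m"
  using assms(3)
proof (induction m arbitrary: L)
  case 0
  have "measure_pmf.expectation (replicate_pmf L (pmf_of_set (UNIV :: bool set)))
      (\<lambda>x. of_bool (\<not> has_chunk_prefix l y x)) \<le>
    measure_pmf.expectation (replicate_pmf L (pmf_of_set (UNIV :: bool set))) (\<lambda>x. 1 :: real)"
    by (intro expectation_mono_finite finite_set_coins) auto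
  then show ?case by simp
next
  case (Suc m)
  let ?u = "\<lambda>n. replicate_pmf n (pmf_of_set (UNIV :: bool set))"
  define L' where "L' = L - l"
  have L: "L = l + L'" "m * l \<le> L'"
    using Suc.prems by (auto simp: L'_def)
  let ?v = "measure_pmf.expectation (?u L') (\<lambda>x. of_bool (\<not> has_chunk_prefix l y x)) :: real"
  have split: "of_bool (\<not> has_chunk_prefix l y (xs @ ys)) =
      (of_bool (take (length y) xs \<noteq> y) * of_bool (\<not> has_chunk_prefix l y ys) :: real)"
    if "length xs = l" for xs ys
    using that assms(1) by (auto simp: has_chunk_prefix_def chunks_append)
  have "measure_pmf.expectation (?u L) (\<lambda>x. of_bool (\<not> has_chunk_prefix l y x)) =
    measure_pmf.expectation (?u l) (\<lambda>xs. measure_pmf.expectation (?u L')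
      (\<lambda>ys. of_bool (\<not> has_chunk_prefix l y (xs @ ys)) :: real))"
    unfolding L(1) replicate_pmf_distrib
    by (simp add: expectation_bind_finite finite_set_coins)
  also have "\<dots> = measure_pmf.expectation (?u l) (\<lambda>xs. measure_pmf.expectation (?u L')
      (\<lambda>ys. of_bool (take (length y) xs \<noteq> y) * of_bool (\<not> has_chunk_prefix l y ys) :: real))"
    by (intro integral_cong_AE) (auto simp: AE_measure_pmf_iff split set_replicate_pmf)
  also have "\<dots> = measure_pmf.expectation (?u l) (\<lambda>xs. of_bool (take (length y) xs \<noteq> y)) * ?v"
    by simp
  also have "measure_pmf.expectation (?u l) (\<lambda>xs. of_bool (take (length y) xs \<noteq> y)) =
      measure_pmf.expectation (map_pmf (take (length y)) (?u l)) (\<lambda>x. of_bool (x \<noteq> y) :: real)"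
    by simp
  also have "\<dots> = 1 - 1 / 2 ^ length y"
    unfolding map_take_replicate_pmf[OF assms(2)] expectation_neq by (simp add: pmf_replicate_coin)
  also have "(1 - 1 / 2 ^ length y) * ?v \<le> (1 - 1 / 2 ^ length y) * (1 - 1 / 2 ^ length y) ^ m"
    using Suc.IH[OF L(2)] by (intro mult_left_mono) auto
  finally show ?case by simp
qed

text \<open>Given the symbols, a string is missed by \<open>n \<ge> A\<close> blocks with probability at most
  \<open>exp (- (\<Sum>j<A. r j))\<close>, where \<open>r j\<close> is the hitting probability of an edit of symbol \<open>j\<close>;
  this bound is a product of independent factors, and an edit of a uniform string is uniform.\<close>

lemma expectation_miss_prob_power_le:
  fixes A L l n :: nat and y :: "bool list" and \<delta> :: real
  assumes "0 < A" "A \<le> n"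
  defines "u \<equiv> measure_pmf.expectation (replicate_pmf L (pmf_of_set (UNIV :: bool set)))
    (\<lambda>x. of_bool (has_chunk_prefix l y x))"
  shows "measure_pmf.expectation (source_symbols_pmf A L) (\<lambda>Xs. miss_prob \<delta> l Xs y ^ n)
    \<le> exp (- (real A * u / 2))"
proof -
  define U where "U = replicate_pmf L (pmf_of_set (UNIV :: bool set))"
  define r where "r = (\<lambda>x. measure_pmf.expectation (edit_pmf \<delta> x)
    (\<lambda>x. of_bool (has_chunk_prefix l y x) :: real))"
  have finU: "finite (set_pmf U)" unfolding U_def by (rule finite_set_coins)
  have sym: "source_symbols_pmf A L = replicate_pmf A U"
    by (simp add: source_symbols_pmf_def U_def pmf_of_set_length)
  have "r x \<le> measure_pmf.expectation (edit_pmf \<delta> x) (\<lambda>x. 1)" for x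
    unfolding r_def by (intro expectation_mono_finite finite_set_edit_pmf) auto
  then have r: "0 \<le> r x" "r x \<le> 1" for x
    by (simp_all add: r_def)
  have "miss_prob \<delta> l Xs y ^ n \<le> prod_list (map (\<lambda>x. exp (- r x)) Xs)"
    if "Xs \<in> set_pmf (source_symbols_pmf A L)" for Xs
  proof -
    have len: "length Xs = A" "Xs \<noteq> []"
      using that assms(1) by (auto simp: set_source_symbols_pmf)
    define q where "q = (\<Sum>j<A. r (Xs ! j)) / A"
    have "miss_prob \<delta> l Xs y = (\<Sum>j<A. 1 - r (Xs ! j)) / A"
      unfolding miss_prob_def expectation_source_block_pmf[OF len(2)] r_def len(1) of_bool_not_iff
      by (simp add: integrable_measure_pmf_finite finite_set_edit_pmf)
    also have "\<dots> = 1 - q"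
      using assms(1) by (simp add: q_def sum_subtractf diff_divide_distrib)
    finally have miss: "miss_prob \<delta> l Xs y = 1 - q" .
    have q: "0 \<le> q" unfolding q_def by (intro divide_nonneg_nonneg sum_nonneg r) simp
    have "miss_prob \<delta> l Xs y \<le> exp (- q)"
      unfolding miss using exp_ge_add_one_self[of "- q"] by simp
    then have "miss_prob \<delta> l Xs y ^ n \<le> exp (- q) ^ n"
      by (intro power_mono) (simp_all add: miss_prob_def)
    \<comment> \<open>Keeping \<open>A\<close> of the \<open>n\<close> factors turns the average
      \<open>q\<close> into the sum over the symbols, so the bound factors over them.\<close>
    also have "\<dots> \<le> exp (- q) ^ A"
      using assms(2) q by (intro power_decreasing) auto
    also have "\<dots> = exp (- (real A * q))"
      by (simp add: exp_of_nat_mult[symmetric])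
    also have "real A * q = (\<Sum>x\<leftarrow>Xs. r x)"
      using assms(1) len(1) by (simp add: q_def sum_list_sum_nth atLeast0LessThan)
    also have "exp (- (\<Sum>x\<leftarrow>Xs. r x)) = prod_list (map (\<lambda>x. exp (- r x)) Xs)"
      by (induction Xs) (simp_all add: exp_diff exp_minus field_simps)
    finally show ?thesis .
  qed
  then have "measure_pmf.expectation (source_symbols_pmf A L) (\<lambda>Xs. miss_prob \<delta> l Xs y ^ n) \<le>
      measure_pmf.expectation (source_symbols_pmf A L) (\<lambda>Xs. prod_list (map (\<lambda>x. exp (- r x)) Xs))"
    by (intro expectation_mono_finite finite_set_source_symbols_pmf)
  also have "\<dots> = measure_pmf.expectation U (\<lambda>x. exp (- r x)) ^ A"
    unfolding sym by (rule expectation_prod_list_replicate[OF finU])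
  also have "\<dots> \<le> exp (- (u / 2)) ^ A"
  proof (rule power_mono)
    have "measure_pmf.expectation U (\<lambda>x. exp (- r x)) \<le> measure_pmf.expectation U (\<lambda>x. 1 - r x / 2)"
      by (intro expectation_mono_finite[OF finU] exp_minus_le_linear r)
    also have "\<dots> = 1 - measure_pmf.expectation U r / 2"
      by (simp add: integrable_measure_pmf_finite[OF finU])
    also have "measure_pmf.expectation U r =
        measure_pmf.expectation (U \<bind> edit_pmf \<delta>) (\<lambda>x. of_bool (has_chunk_prefix l y x))"
      unfolding r_def by (rule expectation_bind_finite[OF finU finite_set_edit_pmf, symmetric])
    also have "U \<bind> edit_pmf \<delta> = U"
      using edit_uniform_pmf[of L \<delta>] by (simp add: U_def pmf_of_set_length)
    also have "measure_pmf.expectation U (\<lambda>x. of_bool (has_chunk_prefix l y x)) = u"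
      by (simp add: U_def u_def)
    finally show "measure_pmf.expectation U (\<lambda>x. exp (- r x)) \<le> exp (- (u / 2))"
      using exp_ge_add_one_self[of "- (u / 2)"] by simp
  qed simp
  also have "\<dots> = exp (- (real A * u / 2))"
    by (simp add: exp_of_nat_mult[symmetric])
  finally show ?thesis .
qed

text \<open>Strings of length about \<open>l/2\<close> suffice as prefixes, and by the bound on \<open>l * 2 ^ l\<close> each of
  them is expected many times among the \<open>A * (L div l)\<close> chunks of the source symbols.\<close>

lemma prefixes_le_chunk_number:
  fixes C :: real
  assumes "0 < C" "0 < l" "l \<le> L" "real l * 2 ^ l \<le> C * (real A * real L)" "4096 * C \<le> real A"
  shows "8 * 2 ^ (l div 2 + 2) \<le> real A * real (L div l)"
proof -
  \<comment> \<open>Up to rounding, \<open>w\<close> is the number of chunks of the source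
    symbols.\<close>
  define w where "w = real A * real L / real l"
  have "real A * 1 \<le> real A * (real L / real l)"
    using assms(2,3) by (intro mult_left_mono) auto
  then have w: "real A \<le> w" by (simp add: w_def)
  have l2: "2 ^ l \<le> C * w"
    using assms(2,4) by (simp add: w_def field_simps)
  have "((2 :: real) ^ (l div 2 + 2)) ^ 2 = 2 ^ (2 * (l div 2) + 4)"
    by (simp add: power_mult[symmetric] power_add mult_ac)
  also have "\<dots> \<le> 2 ^ (l + 4)" by (intro power_increasing) auto
  also have "\<dots> \<le> 16 * (C * w)" using l2 by (simp add: power_add)
  \<comment> \<open>The constant 4096 is \<open>16 * 16 ^ 2\<close>. The target
    \<open>w / 16\<close> supplies the factor 8 of the claim and a factor 2 lost to rounding in
    \<open>L div l\<close>.\<close>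
  also have "\<dots> \<le> (w / 16) ^ 2"
    using mult_right_mono[of "4096 * C" w w] assms(1,5) w
    by (simp add: power2_eq_square field_simps)
  finally have sq: "((2 :: real) ^ (l div 2 + 2)) ^ 2 \<le> (w / 16) ^ 2" .
  have "0 \<le> w / 16" using w by simp
  then have "2 ^ (l div 2 + 2) \<le> w / 16" by (rule power2_le_imp_le[OF sq])
  moreover have "w / 2 \<le> real A * real (L div l)"
  proof -
    have "real L / real l / 2 \<le> real (L div l)"
      using half_le_full_chunks[OF assms(2,3)] assms(2) by (simp add: field_simps)
    then have "real A * (real L / real l / 2) \<le> real A * real (L div l)"
      by (rule mult_left_mono) simp
    then show ?thesis by (simp add: w_def)
  qed
  ultimately show ?thesis by linarith
qed

text \<open>An edit of a uniform symbol hits a given prefix with probability at least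
  \<open>min 1 z / 2\<close>, where \<open>z\<close> is the expected number of hits among its full
  chunks. Over all \<open>A\<close> symbols this makes the miss probability at most
  \<open>exp (-2)\<close>.\<close>

lemma expectation_mFLD_length_ge_few_chunks:
  fixes C :: real
  assumes pos: "4 \<le> l" "l \<le> L" and A: "8 \<le> A" "4096 * C \<le> real A" "A \<le> B div 2"
    and C: "0 < C" "real l * 2 ^ l \<le> C * (real A * real L)"
  shows "1 / 12 * real B * real L \<le>
    measure_pmf.expectation (source_pmf A B L \<delta>) (\<lambda>s. real (mFLD_length L l s))"
proof -
  \<comment> \<open>The summand 2 pays for the rounding of \<open>l div 2\<close> and for the 1
    subtracted from the logarithm of \<open>card G\<close>.\<close>
  define h where "h = l div 2 + 2"
  define m where "m = L div l"
  define G where "G = {y :: bool list. length y = h}"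
  have hl: "h \<le> l" using pos by (simp add: h_def)
  have G: "finite G" "G \<noteq> {}" "card G = 2 ^ h"
    using finite_lists_length lists_length_nonempty card_lists_length_eq[of "UNIV :: bool set" h]
    by (auto simp: G_def)
  have Am: "8 * 2 ^ h \<le> real A * real m"
    unfolding h_def m_def using pos A C by (intro prefixes_le_chunk_number) auto
  note fin = finite_set_source_symbols_pmf[of A L]
  have small: "measure_pmf.expectation (source_symbols_pmf A L) (\<lambda>Xs. miss_prob \<delta> l Xs y ^ (B div 2))
      \<le> 1 / 4" if "y \<in> G" for y
  proof -
    define u where "u = measure_pmf.expectation (replicate_pmf L (pmf_of_set (UNIV :: bool set)))
      (\<lambda>x. of_bool (has_chunk_prefix l y x) :: real)"
    define z where "z = real m / 2 ^ h"
    have y: "length y = h" using that by (simp add: G_def)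
    have "1 - u = measure_pmf.expectation (replicate_pmf L (pmf_of_set (UNIV :: bool set)))
        (\<lambda>x. of_bool (\<not> has_chunk_prefix l y x))"
      by (simp add: u_def of_bool_not_iff integrable_measure_pmf_finite finite_set_coins)
    also have "\<dots> \<le> (1 - 1 / 2 ^ h) ^ m"
      using uniform_miss_prob_le[of l y m L] pos hl y by (simp add: m_def)
    also have "\<dots> \<le> exp (- (1 / 2 ^ h)) ^ m"
      using exp_ge_add_one_self[of "- (1 / 2 ^ h :: real)"] by (intro power_mono) auto
    also have "\<dots> = exp (- z)"
      by (simp add: exp_of_nat_mult[symmetric] z_def)
    also have "\<dots> \<le> 1 - min 1 z / 2"
      by (rule exp_minus_le_min) (simp add: z_def)
    finally have "min 1 z / 2 \<le> u" by simp
    then have "real A * (min 1 z / 2) \<le> real A * u" by (rule mult_left_mono) simp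
    \<comment> \<open>If the minimum is 1, this is \<open>8 \<le> A\<close>; otherwise it is
      \<open>Am\<close>.\<close>
    moreover have "8 \<le> real A * min 1 z"
      using A(1) Am by (simp add: min_def z_def field_simps)
    ultimately have "2 \<le> real A * u / 2" by simp
    then have "exp (- (real A * u / 2)) \<le> exp (- 2)" by simp
    also have "\<dots> \<le> 1 / 4"
      using exp_lower_Taylor_quadratic[of 2] by (simp add: exp_minus inverse_eq_divide field_simps)
    finally show ?thesis
      using expectation_miss_prob_power_le[where A = A and n = "B div 2" and \<delta> = \<delta> and l = l and y = y and L = L] A
      by (simp add: u_def)
  qed
  show ?thesis
  proof (rule expectation_mFLD_length_ge[where G = "\<lambda>_. G" and h = h])
    have "log 2 (card G) = real h" by (simp add: G(3))
    then have "real l / 2 \<le> log 2 (card G) - 1" unfolding h_def by linarith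
    then show "finite G \<and> G \<noteq> {} \<and> (\<forall>y\<in>G. length y = h) \<and> real l / 2 \<le> log 2 (card G) - 1"
      using G by (simp add: G_def)
  next
    have "measure_pmf.expectation (source_symbols_pmf A L) (\<lambda>Xs.
        (\<Sum>y\<in>G. miss_prob \<delta> l Xs y ^ (B div 2)) / card G) =
      (\<Sum>y\<in>G. measure_pmf.expectation (source_symbols_pmf A L)
        (\<lambda>Xs. miss_prob \<delta> l Xs y ^ (B div 2))) / card G"
      by (simp add: integrable_measure_pmf_finite[OF fin])
    also have "\<dots> \<le> (card G * (1 / 4)) / card G"
      by (intro divide_right_mono sum_bounded_above small) auto
    also have "\<dots> = 1 / 4" by (simp add: G(3))
    finally show "measure_pmf.expectation (source_symbols_pmf A L) (\<lambda>Xs.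
        (\<Sum>y\<in>G. miss_prob \<delta> l Xs y ^ (B div 2)) / card G) \<le> 1 / 4" .
  qed (use pos A in auto)
qed

section \<open>Combination of the cases and choice of the error term\<close>

theorem theorem6:
  fixes A L l :: "nat \<Rightarrow> nat" and k1 k2 :: real
  assumes k1: "0 < k1" and k2: "0 < k2" "k2 < 1"
    and A_pos: "\<And>B. 0 < B \<Longrightarrow> 0 < A B"
    and L_pos: "\<And>B. 0 < B \<Longrightarrow> 0 < L B"
    and A_lim: "filterlim A at_top at_top"
    and L_lim: "filterlim L at_top at_top"
    and A_le: "\<forall>\<^sub>F B in at_top. real (A B) \<le> real B powr (1 - k2)"
    and L_Theta: "(\<lambda>B. real (L B)) \<in> \<Theta>(\<lambda>B. real B powr k1)"
    and l_range: "\<And>B. 0 < B \<Longrightarrow> 0 < l B \<and> l B \<le> L B"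
  shows "\<exists>\<epsilon> :: nat \<Rightarrow> real. \<epsilon> \<longlonglongrightarrow> 0 \<and>
    (\<forall>\<delta>. 0 < \<delta> \<and> \<delta> < 1 / 2 \<longrightarrow> (\<forall>B > 0.
       (\<lambda>n. real (l n) * 2 ^ l n) \<in> O(\<lambda>n. real (A n) * real (L n)) \<or>
       real (l B) \<le> (log 2 (real B / real (A B)) - 2) / cross_entropy (1 / 2) \<delta> \<longrightarrow>
       measure_pmf.expectation (source_pmf (A B) B (L B) \<delta>)
           (\<lambda>s. real (mFLD_length (L B) (l B) s))
         \<ge> 1 / 12 * real B * real (L B) * (1 + \<epsilon> B)))"
proof -
  define E where "E = (\<lambda>\<delta> B. measure_pmf.expectation (source_pmf (A B) B (L B) \<delta>)
    (\<lambda>s. real (mFLD_length (L B) (l B) s)))"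
  define few where "few \<longleftrightarrow> (\<lambda>n. real (l n) * 2 ^ l n) \<in> O(\<lambda>n. real (A n) * real (L n))"
  have tiny: "1 / 12 * real B * real (L B) \<le> E \<delta> B" if "0 < B" "l B \<le> 12" for \<delta> B
  proof -
    have "real B * real (L B) / 12 \<le> real B * real (L B) / real (l B)"
      using that l_range[of B] by (intro divide_left_mono) auto
    also have "\<dots> \<le> E \<delta> B"
      unfolding E_def using that l_range[of B] A_pos L_pos
      by (intro expectation_mFLD_length_ge_chunk_count) auto
    finally show ?thesis by simp
  qed
  have short: "1 / 12 * real B * real (L B) \<le> E \<delta> B"
    if "0 < B" "0 < \<delta>" "\<delta> < 1 / 2"
      "real (l B) \<le> (log 2 (real B / real (A B)) - 2) / cross_entropy (1 / 2) \<delta>" for \<delta> B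
  proof (cases "l B \<le> 12")
    case False
    then show ?thesis
      unfolding E_def using that l_range[of B] A_pos[of B]
      by (intro expectation_mFLD_length_ge_short_chunks) auto
  qed (use tiny that in auto)
  \<comment> \<open>The threshold is quantified before \<open>\<delta>\<close>, which makes the
    error term independent of \<open>\<delta>\<close>.\<close>
  have "\<exists>B0. \<forall>\<delta> B. B0 \<le> B \<longrightarrow> 0 < B \<longrightarrow> 1 / 12 * real B * real (L B) \<le> E \<delta> B" if few
  proof -
    from that have "(\<lambda>n. real (l n) * 2 ^ l n) \<in> O(\<lambda>n. real (A n) * real (L n))"
      by (simp add: few_def)
    then obtain C :: real where C: "0 < C"
        "\<forall>\<^sub>F n in at_top. norm (real (l n) * 2 ^ l n) \<le> C * norm (real (A n) * real (L n))"
      by (elim landau_o.bigE)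
    \<comment> \<open>Together with the polynomial gap between \<open>A\<close> and \<open>B\<close>
      this gives \<open>A B \<le> B / 4\<close> eventually, so the first half contains at least
      \<open>A B\<close> blocks.\<close>
    have "(\<lambda>B. real B powr (- k2)) \<longlonglongrightarrow> 0"
      using k2 by (intro tendsto_neg_powr filterlim_real_sequentially) auto
    then have "\<forall>\<^sub>F B in at_top. real B powr (- k2) < 1 / 4"
      by (rule order_tendstoD) simp
    moreover have "\<forall>\<^sub>F B in at_top. max 8 (nat \<lceil>4096 * C\<rceil>) \<le> A B"
      using A_lim unfolding filterlim_at_top by blast
    ultimately have "\<forall>\<^sub>F B in at_top. 0 < B \<longrightarrow> (\<forall>\<delta>. 1 / 12 * real B * real (L B) \<le> E \<delta> B)"
      using C(2) A_le eventually_ge_at_top[of "4 :: nat"]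
    proof eventually_elim
      case (elim B)
      have "real B powr (1 - k2) = real B * real B powr (- k2)"
        using elim(5) by (simp add: powr_add[symmetric] powr_mult_base)
      also have "\<dots> \<le> real B * (1 / 4)"
        using elim(1) by (intro mult_left_mono) auto
      finally have "real (A B) \<le> real B / 4" using elim(4) by linarith
      then have AB: "A B \<le> B div 2" using elim(5) by linarith
      have A8: "8 \<le> A B" "4096 * C \<le> real (A B)" using elim(2) by linarith+
      show ?case
      proof (intro impI allI)
        fix \<delta> assume B: "0 < B"
        show "1 / 12 * real B * real (L B) \<le> E \<delta> B"
        proof (cases "l B \<le> 12")
          case False
          then show ?thesis
            unfolding E_def using AB A8 C(1) elim(3) l_range[OF B]
            by (intro expectation_mFLD_length_ge_few_chunks[of _ _ _ C]) auto
        qed (use tiny B in auto)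
      qed
    qed
    then show ?thesis by (auto simp: eventually_at_top_linorder)
  qed
  then obtain B0 where B0: "\<And>\<delta> B. few \<Longrightarrow> B0 \<le> B \<Longrightarrow> 0 < B \<Longrightarrow> 1 / 12 * real B * real (L B) \<le> E \<delta> B"
    by blast
  \<comment> \<open>The value \<open>- 1\<close> makes the claim trivial below the threshold, since
    lengths are nonnegative.\<close>
  define \<epsilon> :: "nat \<Rightarrow> real" where "\<epsilon> = (\<lambda>B. if B < B0 then - 1 else 0)"
  have "\<epsilon> \<longlonglongrightarrow> 0"
  proof (rule tendsto_eventually)
    show "\<forall>\<^sub>F B in at_top. \<epsilon> B = 0"
      using eventually_ge_at_top[of B0] by eventually_elim (simp add: \<epsilon>_def)
  qed
  moreover have "1 / 12 * real B * real (L B) * (1 + \<epsilon> B) \<le> E \<delta> B"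
    if "0 < \<delta>" "\<delta> < 1 / 2" "0 < B"
      "few \<or> real (l B) \<le> (log 2 (real B / real (A B)) - 2) / cross_entropy (1 / 2) \<delta>" for \<delta> B
  proof (cases "B < B0")
    case True
    then show ?thesis by (simp add: \<epsilon>_def E_def)
  next
    case False
    then show ?thesis using that B0[of B \<delta>] short[of B \<delta>] by (auto simp: \<epsilon>_def)
  qed
  ultimately show ?thesis unfolding few_def E_def by blast
qed

end
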